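(* Let $F$ be a marked, weighted graph with an unlooped, unmarked vertex $a$ that has standard weights, and let $\alpha(a),\beta(a),\alpha(a_m)\in R$ be universal weights for $(F,a)$ (as defined in the context). For $(i,j)\in\{(1,0),(0,1)\}$ let $F^{ij}$ be the graph obtained from $F$ by replacing $a$ with an unlooped, unmarked vertex $v_{ij}$ that has the same neighbors as $a$ and whose weights are $\alpha(v_{ij})=i$ and $\beta(v_{ij})=j$. Then $$\begin{aligned} (2-d-d^{2})\,\alpha(a) &= -(d+1)[F-a]+[F^{10}]+[F^{01}],\\ (2-d-d^{2})\,\beta(a) &= [F-a]+[F^{10}]-(d+1)[F^{01}],\\ (2-d-d^{2})\,\alpha(a_m) &= [F-a]-(d+1)[F^{10}]+[F^{01}]. \end{aligned}$$
   Context: A graph $G=(V(G),E(G))$ is finite and may have loops, multiple edges, and free loops (connected components that contain neither vertices nor edges). A marked graph is a graph each of whose vertices is designated either marked or unmarked. A weighted, marked graph is a marked graph given with functions $\alpha,\beta:V(G)\to R$, where $R$ is a fixed commutative ring containing elements $A,B,d$. A vertex $v$ has standard weights if $\alpha(v)=A$ and $\beta(v)=B$. If $V(G)=\{v_1,\dots,v_n\}$, the Boolean adjacency matrix $\mathcal{A}(G)$ is the $n\times n$ matrix over $GF(2)$ with $\mathcal{A}(G)_{ii}=1$ iff $v_i$ is looped and, for $i\neq j$, $\mathcal{A}(G)_{ij}=1$ iff $v_i$ and $v_j$ are adjacent. For $T\subseteq V(G)$, $\mathcal{A}(G)_T$ is obtained from $\mathcal{A}(G)$ by first changing the $i$th diagonal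 entry whenever $v_i\in T$, and then removing the $i$th row and column whenever $v_i$ is marked and the (new) $i$th diagonal entry is $0$. The weighted marked-graph bracket polynomial is $$[G]=d^{\phi}\sum_{T\subseteq V(G)}\Big(\prod_{v\notin T}\alpha(v)\Big)\Big(\prod_{t\in T}\beta(t)\Big)d^{\nu(\mathcal{A}(G)_T)},$$ where $\phi$ is the number of free loops of $G$ and $\nu$ is the $GF(2)$-nullity (the empty matrix has nullity $0$). $G-v$ is obtained by removing $v$ and all edges incident on $v$ (free loops are kept). Composition: a marked, weighted graph $G$ is the composition $F\ast H$ of marked, weighted graphs $F$ and $H$ if: (a) $V(F)\cap V(H)$ consists of a single unlooped, unmarked vertex $a$ that has standard weights in both $F$ and $H$; (b) the elements of $V(G)=V(F)\cup V(H)-\{a\}$ inherit their loops, marks and weights from $F$ and $H$; (c) $E(G)=E(F-a)\cup E(H-a)\cup\{\{v,w\} : \{v,a\}\in E(F)\text{ and }\{a,w\}\in E(H)\}$; (d) $F$ and $H$ do not share any free loop, and the free loops of $G$ are those of $F$ and $H$. Universal weights: elements $\alpha(a),\beta(a),\alpha(a_m)\in R$ are universal weights for $(F,a)$ if every composition $F\ast H$ with a marked, weighted graph $H$ in which no neighbor of $a$ is marked satisfies $[F\ast H]=[H']+[H'_m]$, where $H'$ is obtained from $H$ by changing the weights of $a$ to $\alpha(a)$ and $\beta(a)$, and $H'_m$ is obtained from $H$ by marking $a$ and changing its weights to $\alpha(a_m)$ and $0$. (Universal weights always exist. In the formulas, $\alpha(a),\beta(a)$ denote these universal weights, not the standard weights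 of $a$ in $F$.) *)

theory Defs
  imports
    "HOL-Library.Z2"
    "HOL-Library.Multiset"
    "HOL-Library.Function_Algebras"
    "HOL-Library.Infinite_Typeclass"
begin

text \<open>
  An edge is the set of its end-vertices, so a singleton is a loop; parallel edges are recorded by
  multiplicity. Free loops are named objects, so that two graphs may or may not share one. Weights
  are total functions of which only the values on the vertices matter.
\<close>

record ('v, 'l, 'r) mwgraph =
  verts :: "'v set"
  edges :: "'v set multiset"
  free_loops :: "'l set"
  marked :: "'v set"
  alpha :: "'v \<Rightarrow> 'r"
  beta :: "'v \<Rightarrow> 'r"

definition is_mwgraph :: "('v, 'l, 'r) mwgraph \<Rightarrow> bool" where
  "is_mwgraph G \<longleftrightarrow>
     finite (verts G) \<and>
     (\<forall>e \<in># edges G. e \<subseteq> verts G \<and> (card e = 1 \<or> card e = 2)) \<and>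
     finite (free_loops G) \<and>
     marked G \<subseteq> verts G"

definition looped :: "('v, 'l, 'r) mwgraph \<Rightarrow> 'v \<Rightarrow> bool" where
  "looped G v \<longleftrightarrow> {v} \<in># edges G"

definition adjacent :: "('v, 'l, 'r) mwgraph \<Rightarrow> 'v \<Rightarrow> 'v \<Rightarrow> bool" where
  "adjacent G v w \<longleftrightarrow> v \<noteq> w \<and> {v, w} \<in># edges G"

definition standard_weights :: "'r \<Rightarrow> 'r \<Rightarrow> ('v, 'l, 'r) mwgraph \<Rightarrow> 'v \<Rightarrow> bool" where
  "standard_weights A B G v \<longleftrightarrow> alpha G v = A \<and> beta G v = B"

text \<open>
  Matrices over \<open>GF(2)\<close>, realised as the type \<^typ>\<open>bit\<close>, are indexed by a finite set \<open>S\<close> of vertices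
  rather than by an enumeration of them. A column vector over \<open>S\<close> is a function vanishing outside
  \<open>S\<close>.
\<close>

definition null_space :: "'v set \<Rightarrow> ('v \<Rightarrow> 'v \<Rightarrow> bit) \<Rightarrow> ('v \<Rightarrow> bit) set" where
  "null_space S M =
     {x. (\<forall>i. i \<notin> S \<longrightarrow> x i = 0) \<and> (\<forall>i \<in> S. (\<Sum>j \<in> S. M i j * x j) = 0)}"

definition nullity :: "'v set \<Rightarrow> ('v \<Rightarrow> 'v \<Rightarrow> bit) \<Rightarrow> nat" where
  "nullity S M = vector_space.dim (\<lambda>(c::bit) x i. c * x i) (null_space S M)"

lemma vector_space_bit_fun: "vector_space (\<lambda>(c::bit) (x :: 'v \<Rightarrow> bit) i. c * x i)"
  by unfold_locales (auto simp: fun_eq_iff algebra_simps)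

definition adj_matrix :: "('v, 'l, 'r) mwgraph \<Rightarrow> 'v \<Rightarrow> 'v \<Rightarrow> bit" where
  "adj_matrix G i j = of_bool (if i = j then looped G i else adjacent G i j)"

definition toggled_matrix :: "('v, 'l, 'r) mwgraph \<Rightarrow> 'v set \<Rightarrow> 'v \<Rightarrow> 'v \<Rightarrow> bit" where
  "toggled_matrix G T i j =
     (if i = j \<and> i \<in> T then adj_matrix G i j + 1 else adj_matrix G i j)"

text \<open>The vertices whose rows and columns survive in \<open>\<A>(G)\<^sub>T\<close>.\<close>

definition kept_indices :: "('v, 'l, 'r) mwgraph \<Rightarrow> 'v set \<Rightarrow> 'v set" where
  "kept_indices G T = {v \<in> verts G. \<not> (v \<in> marked G \<and> toggled_matrix G T v v = 0)}"

definition bracket :: "'r::comm_ring_1 \<Rightarrow> ('v, 'l, 'r) mwgraph \<Rightarrow> 'r" where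
  "bracket d G =
     d ^ card (free_loops G) *
     (\<Sum>T \<in> Pow (verts G).
        (\<Prod>v \<in> verts G - T. alpha G v) * (\<Prod>t \<in> T. beta G t) *
        d ^ nullity (kept_indices G T) (toggled_matrix G T))"

definition delete_vertex :: "('v, 'l, 'r) mwgraph \<Rightarrow> 'v \<Rightarrow> ('v, 'l, 'r) mwgraph" where
  "delete_vertex G v =
     G\<lparr>verts := verts G - {v}, edges := {#e \<in># edges G. v \<notin> e#}, marked := marked G - {v}\<rparr>"

text \<open>
  The edges between \<open>F\<close> and \<open>H\<close> are taken with multiplicity one; the bracket does not depend on
  edge multiplicities.
\<close>

definition is_composition ::
  "'r \<Rightarrow> 'r \<Rightarrow> 'v \<Rightarrow> ('v, 'l, 'r) mwgraph \<Rightarrow> ('v, 'l, 'r) mwgraph \<Rightarrow> ('v, 'l, 'r) mwgraph \<Rightarrow> bool"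
where
  "is_composition A B a F H G \<longleftrightarrow>
     is_mwgraph F \<and> is_mwgraph H \<and> is_mwgraph G \<and>
     verts F \<inter> verts H = {a} \<and>
     \<not> looped F a \<and> \<not> looped H a \<and>
     a \<notin> marked F \<and> a \<notin> marked H \<and>
     standard_weights A B F a \<and> standard_weights A B H a \<and>
     verts G = verts F \<union> verts H - {a} \<and>
     (\<forall>v \<in> verts F - {a}. (v \<in> marked G \<longleftrightarrow> v \<in> marked F) \<and>
        alpha G v = alpha F v \<and> beta G v = beta F v) \<and>
     (\<forall>v \<in> verts H - {a}. (v \<in> marked G \<longleftrightarrow> v \<in> marked H) \<and>
        alpha G v = alpha H v \<and> beta G v = beta H v) \<and>
     edges G = edges (delete_vertex F a) + edges (delete_vertex H a) +
       mset_set {{v, w} | v w. {v, a} \<in># edges F \<and> {a, w} \<in># edges H} \<and>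
     free_loops F \<inter> free_loops H = {} \<and>
     free_loops G = free_loops F \<union> free_loops H"

definition reweight ::
  "('v, 'l, 'r) mwgraph \<Rightarrow> 'v \<Rightarrow> 'r \<Rightarrow> 'r \<Rightarrow> ('v, 'l, 'r) mwgraph" where
  "reweight G a x y = G\<lparr>alpha := (alpha G)(a := x), beta := (beta G)(a := y)\<rparr>"

definition mark_vertex :: "('v, 'l, 'r) mwgraph \<Rightarrow> 'v \<Rightarrow> ('v, 'l, 'r) mwgraph" where
  "mark_vertex G a = G\<lparr>marked := insert a (marked G)\<rparr>"

text \<open>
  \<open>x\<close>, \<open>y\<close>, \<open>x\<^sub>m\<close> play the roles of \<open>\<alpha>(a)\<close>, \<open>\<beta>(a)\<close>, \<open>\<alpha>(a\<^sub>m)\<close>. The types of vertices and of free loops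
  are required to be infinite so that, whatever the finite graph \<open>F\<close>, \<open>H\<close> ranges over marked,
  weighted graphs of every isomorphism type.
\<close>

definition universal_weights ::
  "'r::comm_ring_1 \<Rightarrow> 'r \<Rightarrow> 'r \<Rightarrow> ('v::infinite, 'l::infinite, 'r) mwgraph \<Rightarrow> 'v \<Rightarrow>
   'r \<Rightarrow> 'r \<Rightarrow> 'r \<Rightarrow> bool"
where
  "universal_weights A B d F a x y x\<^sub>m \<longleftrightarrow>
     (\<forall>H G. is_composition A B a F H G \<longrightarrow> (\<forall>w. adjacent H a w \<longrightarrow> w \<notin> marked H) \<longrightarrow>
        bracket d G =
          bracket d (reweight H a x y) + bracket d (mark_vertex (reweight H a x\<^sub>m 0) a))"

text \<open>
  Intended for \<open>a\<close> an unlooped vertex of \<open>F\<close> and \<open>v\<close> a new vertex; then \<open>v\<close> is unlooped and its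
  neighbours are those of \<open>a\<close>.
\<close>

definition replace_vertex ::
  "('v, 'l, 'r) mwgraph \<Rightarrow> 'v \<Rightarrow> 'v \<Rightarrow> 'r \<Rightarrow> 'r \<Rightarrow> ('v, 'l, 'r) mwgraph" where
  "replace_vertex F a v i j =
     F\<lparr>verts := insert v (verts F - {a}),
       edges := image_mset (image (\<lambda>u. if u = a then v else u)) (edges F),
       marked := marked F - {a, v},
       alpha := (alpha F)(v := i), beta := (beta F)(v := j)\<rparr>"

end

theory Submission
  imports Defs
begin

text \<open>
  The universal weights \<open>x\<close>, \<open>y\<close>, \<open>x\<^sub>m\<close> are tested on three graphs \<open>H\<close>: the isolated vertex \<open>a\<close>, and the
  single edge joining \<open>a\<close> to a vertex \<open>v\<close> whose weights are \<open>(1, 0)\<close> or \<open>(0, 1)\<close>. The compositions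
  \<open>F * H\<close> are then \<open>F - a\<close>, \<open>F\<^sup>1\<^sup>0\<close> and \<open>F\<^sup>0\<^sup>1\<close> up to edge multiplicity, which gives
  \<open>[F - a] = d x + y + x\<^sub>m\<close>, \<open>[F\<^sup>1\<^sup>0] = x + y + d x\<^sub>m\<close> and \<open>[F\<^sup>0\<^sup>1] = x + d y + x\<^sub>m\<close>.
  The formulas are linear combinations of these three equations.
\<close>

section \<open>GF(2)-nullity of matrices of size at most two\<close>

lemma nullity_eq_0:
  assumes "null_space S M = {0}"
  shows "nullity S M = 0"
proof -
  interpret V: vector_space "\<lambda>(c::bit) (x :: 'a \<Rightarrow> bit) i. c * x i"
    by (rule vector_space_bit_fun)
  have "V.dim {0} = card ({} :: ('a \<Rightarrow> bit) set)"
    by (rule V.dim_unique) (use V.independent_empty V.span_zero in auto)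
  then show ?thesis
    unfolding nullity_def assms by simp
qed

text \<open>Over GF(2) a nonzero vector \<open>e\<close> spans only \<open>0\<close> and
  \<open>e\<close>, so \<open>{e}\<close> is a basis of the null space.\<close>

lemma nullity_eq_1:
  assumes "null_space S M = {0, e}" and "e \<noteq> 0"
  shows "nullity S M = 1"
proof -
  interpret V: vector_space "\<lambda>(c::bit) (x :: 'a \<Rightarrow> bit) i. c * x i"
    by (rule vector_space_bit_fun)
  have "V.dim {0, e} = card {e}"
  proof (rule V.dim_unique)
    show "{0, e} \<subseteq> V.span {e}"
      using V.span_zero V.span_base by auto
    show "V.independent {e}"
      unfolding V.dependent_single by (rule assms(2))
  qed auto
  then show ?thesis
    unfolding nullity_def assms(1) by simp
qed

lemma nullity_empty: "nullity {} M = 0"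
  by (rule nullity_eq_0) (auto simp: null_space_def fun_eq_iff)

lemma nullity_singleton: "nullity {v} M = (if M v v = 0 then 1 else 0)"
proof -
  have mem: "x \<in> null_space {v} M \<longleftrightarrow> (\<forall>i. i \<noteq> v \<longrightarrow> x i = 0) \<and> M v v * x v = 0" for x
  proof -
    have "(\<Sum>j\<in>{v}. M v j * x j) = M v v * x v"
      by (subst sum.insert) auto
    then show ?thesis
      unfolding null_space_def by (simp only: mem_Collect_eq singleton_iff ball_simps simp_thms)
  qed
  show ?thesis
  proof (cases "M v v")
    case zero
    let ?e = "(\<lambda>_. 0)(v := 1 :: bit)"
    have "x \<in> null_space {v} M \<longleftrightarrow> x \<in> {0, ?e}" for x
      unfolding mem using zero by (cases "x v") (auto simp: fun_eq_iff)
    moreover have "?e \<noteq> 0"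
      by (auto simp: fun_eq_iff)
    ultimately show ?thesis
      using zero nullity_eq_1[of "{v}" M ?e] by auto
  next
    case one
    have "x \<in> null_space {v} M \<longleftrightarrow> x \<in> {0}" for x
      unfolding mem using one by (cases "x v") (auto simp: fun_eq_iff)
    then have "nullity {v} M = 0"
      by (intro nullity_eq_0) blast
    then show ?thesis
      using one by simp
  qed
qed

text \<open>The determinant \<open>M a a * M v v - 1\<close> vanishes over GF(2) exactly when both
  diagonal entries are 1; the off-diagonal 1s keep the rank positive.\<close>

lemma nullity_pair:
  assumes "a \<noteq> v" and "M a v = 1" and "M v a = 1"
  shows "nullity {a, v} M = (if M a a = 1 \<and> M v v = 1 then 1 else 0)"
proof -
  have mem: "x \<in> null_space {a, v} M \<longleftrightarrow>
      (\<forall>i. i \<noteq> a \<and> i \<noteq> v \<longrightarrow> x i = 0) \<and> M a a * x a + x v = 0 \<and> x a + M v v * x v = 0" for x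
    using assms by (auto simp: null_space_def)
  show ?thesis
  proof (cases "M a a = 1 \<and> M v v = 1")
    case True
    let ?e = "(\<lambda>_. 0)(a := 1, v := 1 :: bit)"
    have "x \<in> null_space {a, v} M \<longleftrightarrow> x \<in> {0, ?e}" for x
      unfolding mem using True assms(1)
      by (cases "x a"; cases "x v") (auto simp: fun_eq_iff)
    moreover have "?e \<noteq> 0"
      by (auto simp: fun_eq_iff)
    ultimately show ?thesis
      using True nullity_eq_1[of "{a, v}" M ?e] by auto
  next
    case False
    have "x \<in> null_space {a, v} M \<longleftrightarrow> x \<in> {0}" for x
      unfolding mem using False assms(1)
      by (cases "x a"; cases "x v"; cases "M a a"; cases "M v v") (auto simp: fun_eq_iff)
    then have "nullity {a, v} M = 0"
      by (intro nullity_eq_0) blast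
    then show ?thesis
      using False by auto
  qed
qed

section \<open>Brackets: edge multiplicities and the test graphs\<close>

lemma bracket_cong_edges:
  assumes "set_mset E = set_mset (edges G)"
  shows "bracket d (G\<lparr>edges := E\<rparr>) = bracket d G"
proof -
  \<comment> \<open>Loops and adjacency depend only on membership in the edge multiset. This later
    absorbs the parallel edges at the new vertex, which \<open>replace_vertex\<close> keeps and a
    composition does not.\<close>
  have "adj_matrix (G\<lparr>edges := E\<rparr>) = adj_matrix G"
    using assms by (auto simp: fun_eq_iff adj_matrix_def looped_def adjacent_def)
  then have tog: "toggled_matrix (G\<lparr>edges := E\<rparr>) = toggled_matrix G"
    by (intro ext) (auto simp: toggled_matrix_def)
  moreover from tog have "kept_indices (G\<lparr>edges := E\<rparr>) = kept_indices G"
    by (intro ext) (simp add: kept_indices_def)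
  ultimately show ?thesis
    by (simp add: bracket_def)
qed

text \<open>\<open>p\<close> and \<open>q\<close> will be the standard weights \<open>A\<close> and
  \<open>B\<close> that a composition demands at \<open>a\<close>; \<open>reweight\<close> then
  overwrites them.\<close>

definition point_graph :: "'v \<Rightarrow> 'r \<Rightarrow> 'r \<Rightarrow> ('v, 'l, 'r) mwgraph" where
  "point_graph a p q =
     \<lparr>verts = {a}, edges = {#}, free_loops = {}, marked = {}, alpha = (\<lambda>_. p), beta = (\<lambda>_. q)\<rparr>"

definition edge_graph :: "'v \<Rightarrow> 'v \<Rightarrow> 'r \<Rightarrow> 'r \<Rightarrow> 'r \<Rightarrow> 'r \<Rightarrow> ('v, 'l, 'r) mwgraph" where
  "edge_graph a v p q i j =
     \<lparr>verts = {a, v}, edges = {#{a, v}#}, free_loops = {}, marked = {},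
      alpha = (\<lambda>_. i)(a := p), beta = (\<lambda>_. j)(a := q)\<rparr>"

lemmas graph_unfold =
  bracket_def toggled_matrix_def adj_matrix_def looped_def adjacent_def reweight_def
  mark_vertex_def

lemma bracket_point_graph:
  "bracket d (reweight (point_graph a p q :: ('v, 'l, 'r::comm_ring_1) mwgraph) a x y) = d * x + y"
proof -
  let ?G = "reweight (point_graph a p q :: ('v, 'l, 'r::comm_ring_1) mwgraph) a x y"
  have "kept_indices ?G T = {a}" for T
    by (auto simp: kept_indices_def reweight_def point_graph_def)
  then show ?thesis
    by (simp add: graph_unfold point_graph_def nullity_singleton Pow_insert algebra_simps)
qed

lemma bracket_point_graph_marked:
  "bracket d (mark_vertex (reweight (point_graph a p q :: ('v, 'l, 'r::comm_ring_1) mwgraph) a x 0) a) = x"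
proof -
  let ?G = "mark_vertex (reweight (point_graph a p q :: ('v, 'l, 'r::comm_ring_1) mwgraph) a x 0) a"
  \<comment> \<open>The marked vertex has diagonal entry 0 here, so the empty matrix remains; the
    term of \<open>T = {a}\<close> vanishes with the weight 0.\<close>
  have "kept_indices ?G {} = {}"
    by (auto simp: kept_indices_def graph_unfold point_graph_def)
  then show ?thesis
    by (simp add: graph_unfold point_graph_def nullity_empty Pow_insert)
qed

text \<open>The terms belong to \<open>T = {}\<close>, \<open>{v}\<close>, \<open>{a}\<close>,
  \<open>{a, v}\<close> in this order; only in the last is the matrix singular, both diagonal
  entries being 1.\<close>

lemma bracket_edge_graph:
  assumes "a \<noteq> v"
  shows "bracket d (reweight (edge_graph a v p q i j :: ('v, 'l, 'r::comm_ring_1) mwgraph) a x y) =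
           x * i + x * j + y * i + d * y * j"
proof -
  let ?G = "reweight (edge_graph a v p q i j :: ('v, 'l, 'r::comm_ring_1) mwgraph) a x y"
  have "kept_indices ?G T = {a, v}" for T
    by (auto simp: kept_indices_def reweight_def edge_graph_def)
  moreover have "{a, v} - {v} = {a}" "{v, a} - {v} = {a}"
    using assms by auto
  ultimately show ?thesis
    using assms
    by (simp add: graph_unfold edge_graph_def nullity_pair Pow_insert algebra_simps
        doubleton_eq_iff insert_commute)
qed

text \<open>Every \<open>T\<close> containing \<open>a\<close> has weight 0. For the others the
  marked \<open>a\<close> has diagonal entry 0 and drops out, leaving the entry at \<open>v\<close>:
  0 for \<open>T = {}\<close> and 1 for \<open>T = {v}\<close>.\<close>

lemma bracket_edge_graph_marked:
  assumes "a \<noteq> v"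
  shows "bracket d (mark_vertex (reweight (edge_graph a v p q i j :: ('v, 'l, 'r::comm_ring_1) mwgraph) a x 0) a) =
           d * x * i + x * j"
proof -
  let ?G = "mark_vertex (reweight (edge_graph a v p q i j :: ('v, 'l, 'r::comm_ring_1) mwgraph) a x 0) a"
  have "kept_indices ?G T = {v}" if "a \<notin> T" for T
    using assms that by (auto simp: kept_indices_def graph_unfold edge_graph_def)
  then have "kept_indices ?G {} = {v}" "kept_indices ?G {v} = {v}"
    using assms by auto
  moreover have "{a, v} - {v} = {a}" "{v, a} - {v} = {a}"
    using assms by auto
  ultimately show ?thesis
    using assms
    by (simp add: graph_unfold edge_graph_def nullity_singleton Pow_insert algebra_simps
        doubleton_eq_iff insert_commute)
qed

section \<open>Compositions of \<open>F\<close> with the test graphs\<close>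

lemma composition_point_graph:
  assumes "is_mwgraph F" "a \<in> verts F" "\<not> looped F a" "a \<notin> marked F" "standard_weights A B F a"
  shows "is_composition A B a F (point_graph a A B) (delete_vertex F a)"
proof -
  have "is_mwgraph (delete_vertex F a)"
    using assms(1) by (auto simp: is_mwgraph_def delete_vertex_def)
  moreover have "is_mwgraph (point_graph a A B)"
    by (simp add: is_mwgraph_def point_graph_def)
  ultimately show ?thesis
    using assms
    by (simp add: is_composition_def point_graph_def delete_vertex_def looped_def
        standard_weights_def)
qed

text \<open>This form matches the edge set that a composition prescribes. The renaming fixes the
  edges avoiding \<open>a\<close> and moves one end of each edge at \<open>a\<close>.\<close>

lemma set_edges_replace_vertex:
  assumes "is_mwgraph F" "\<not> looped F a"
  shows "set_mset (edges (replace_vertex F a v i j)) =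
    {e. e \<in># edges F \<and> a \<notin> e} \<union> {{u, v} | u. {u, a} \<in># edges F}"
proof -
  let ?f = "\<lambda>e. image (\<lambda>u. if u = a then v else u) e"
  have fix_f: "?f e = e" if "a \<notin> e" for e
    using that by force
  \<comment> \<open>The case \<open>u = a\<close> must be excluded: a loop \<open>{a}\<close> would
    go to \<open>{v}\<close> instead of \<open>{a, v}\<close>.\<close>
  have move: "?f {u, a} = {u, v}" if "{u, a} \<in># edges F" for u
    using that assms(2) by (auto simp: looped_def)
  have end_a: "\<exists>u. e = {u, a}" if "e \<in># edges F" "a \<in> e" for e
  proof -
    have "card e = 1 \<or> card e = 2"
      using that assms(1) by (auto simp: is_mwgraph_def)
    then show ?thesis
      using that(2) by (auto simp: card_1_singleton_iff card_2_iff)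
  qed
  have "set_mset (edges (replace_vertex F a v i j)) = ?f ` set_mset (edges F)"
    by (simp add: replace_vertex_def)
  also have "\<dots> = ?f ` {e. e \<in># edges F \<and> a \<notin> e} \<union> ?f ` {{u, a} | u. {u, a} \<in># edges F}"
    unfolding image_Un[symmetric] by (rule arg_cong[where f = "image ?f"]) (use end_a in blast)
  also have "?f ` {e. e \<in># edges F \<and> a \<notin> e} = {e. e \<in># edges F \<and> a \<notin> e}"
    using fix_f by (simp cong: image_cong_simp)
  also have "?f ` {{u, a} | u. {u, a} \<in># edges F} = {{u, v} | u. {u, a} \<in># edges F}"
  proof -
    have "{{u, a} | u. {u, a} \<in># edges F} = (\<lambda>u. {u, a}) ` {u. {u, a} \<in># edges F}"
      by blast
    moreover have "{{u, v} | u. {u, a} \<in># edges F} = (\<lambda>u. {u, v}) ` {u. {u, a} \<in># edges F}"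
      by blast
    moreover have "(\<lambda>u. ?f {u, a}) ` {u. {u, a} \<in># edges F} =
        (\<lambda>u. {u, v}) ` {u. {u, a} \<in># edges F}"
      by (intro image_cong refl move) simp
    ultimately show ?thesis
      by (simp only: image_image)
  qed
  finally show ?thesis .
qed

text \<open>Composing with a single edge from \<open>a\<close> to \<open>v\<close> lets
  \<open>v\<close> inherit the neighbors of \<open>a\<close>. The composition joins \<open>v\<close>
  to each of them once while renaming keeps parallel edges, so in general \<open>E\<close> agrees
  with the renamed edges only as a set.\<close>

lemma composition_edge_graph:
  fixes F :: "('v, 'l, 'r) mwgraph"
  assumes "is_mwgraph F" "a \<in> verts F" "\<not> looped F a" "a \<notin> marked F" "standard_weights A B F a"
    and "v \<notin> verts F"
  obtains E where
    "is_composition A B a F (edge_graph a v A B i j) (replace_vertex F a v i j\<lparr>edges := E\<rparr>)"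
    "set_mset E = set_mset (edges (replace_vertex F a v i j))"
proof
  let ?N = "{{u, v} | u. {u, a} \<in># edges F}"
  let ?E = "edges (delete_vertex F a) + mset_set ?N"
  let ?H = "edge_graph a v A B i j :: ('v, 'l, 'r) mwgraph"
  let ?G = "replace_vertex F a v i j\<lparr>edges := ?E\<rparr>"
  have "a \<noteq> v"
    using assms by auto
  have edge: "e \<subseteq> verts F \<and> (card e = 1 \<or> card e = 2)" if "e \<in># edges F" for e
    using assms(1) that by (auto simp: is_mwgraph_def)
  \<comment> \<open>Finiteness of \<open>?N\<close> matters because \<open>mset_set\<close> of an
    infinite set is \<open>{#}\<close>.\<close>
  have "?N \<subseteq> (\<lambda>u. {u, v}) ` verts F"
    using edge by blast
  moreover have "finite (verts F)"
    using assms(1) by (simp add: is_mwgraph_def)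
  ultimately have fin: "finite ?N"
    by (meson finite_imageI finite_subset)
  show set_E: "set_mset ?E = set_mset (edges (replace_vertex F a v i j))"
    unfolding set_edges_replace_vertex[OF assms(1,3)] using fin by (simp add: delete_vertex_def)
  have nbr: "u \<in> verts F" "u \<noteq> a" "u \<noteq> v" if "{u, a} \<in># edges F" for u
    using edge[OF that] that assms(3,6) by (auto simp: looped_def)
  have "e \<subseteq> verts ?G \<and> (card e = 1 \<or> card e = 2)" if "e \<in># ?E" for e
  proof -
    from that fin consider "e \<in># edges F" "a \<notin> e" | u where "e = {u, v}" "{u, a} \<in># edges F"
      by (auto simp: delete_vertex_def)
    then show ?thesis
    proof cases
      case 1
      then show ?thesis
        using edge by (auto simp: replace_vertex_def)
    next
      case 2
      then show ?thesis
        using nbr[of u] by (auto simp: replace_vertex_def)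
    qed
  qed
  then have "is_mwgraph ?G"
    using assms(1) by (auto simp: is_mwgraph_def replace_vertex_def)
  moreover have "is_mwgraph ?H"
    using \<open>a \<noteq> v\<close> by (auto simp: is_mwgraph_def edge_graph_def)
  moreover have "{{u, w} | u w. {u, a} \<in># edges F \<and> {a, w} \<in># edges ?H} = ?N"
    by (auto simp: edge_graph_def doubleton_eq_iff)
  moreover have "edges (delete_vertex ?H a) = {#}"
    by (simp add: edge_graph_def delete_vertex_def)
  moreover have "v \<notin> marked F"
    using assms(1,6) by (auto simp: is_mwgraph_def)
  ultimately show "is_composition A B a F ?H ?G"
    using assms \<open>a \<noteq> v\<close>
    by (auto simp: is_composition_def standard_weights_def edge_graph_def replace_vertex_def
        looped_def doubleton_eq_iff)
qed

section \<open>The linear equations for the universal weights\<close>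

lemma universal_weights_delete_vertex:
  fixes F :: "('v::infinite, 'l::infinite, 'r::comm_ring_1) mwgraph"
  assumes "is_mwgraph F" "a \<in> verts F" "\<not> looped F a" "a \<notin> marked F" "standard_weights A B F a"
    and "universal_weights A B d F a x y x\<^sub>m"
  shows "bracket d (delete_vertex F a) = d * x + y + x\<^sub>m"
proof -
  \<comment> \<open>The condition on the neighbors of \<open>a\<close> holds since the test graph
    has no marked vertex.\<close>
  have "w \<notin> marked (point_graph a A B)" for w
    by (simp add: point_graph_def)
  with assms(6) composition_point_graph[OF assms(1-5)]
  have "bracket d (delete_vertex F a) =
      bracket d (reweight (point_graph a A B :: ('v, 'l, 'r) mwgraph) a x y) +
      bracket d (mark_vertex (reweight (point_graph a A B :: ('v, 'l, 'r) mwgraph) a x\<^sub>m 0) a)"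
    unfolding universal_weights_def by blast
  then show ?thesis
    unfolding bracket_point_graph bracket_point_graph_marked .
qed

lemma universal_weights_replace_vertex:
  fixes F :: "('v::infinite, 'l::infinite, 'r::comm_ring_1) mwgraph"
  assumes "is_mwgraph F" "a \<in> verts F" "\<not> looped F a" "a \<notin> marked F" "standard_weights A B F a"
    and "universal_weights A B d F a x y x\<^sub>m" and "v \<notin> verts F"
  shows "bracket d (replace_vertex F a v i j) =
    (x * i + x * j + y * i + d * y * j) + (d * x\<^sub>m * i + x\<^sub>m * j)"
proof -
  obtain E where
    comp: "is_composition A B a F (edge_graph a v A B i j) (replace_vertex F a v i j\<lparr>edges := E\<rparr>)"
    and E: "set_mset E = set_mset (edges (replace_vertex F a v i j))"
    using composition_edge_graph[OF assms(1-5,7)] .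
  have "a \<noteq> v"
    using assms by auto
  have "w \<notin> marked (edge_graph a v A B i j)" for w
    by (simp add: edge_graph_def)
  with assms(6) comp have "bracket d (replace_vertex F a v i j\<lparr>edges := E\<rparr>) =
      bracket d (reweight (edge_graph a v A B i j :: ('v, 'l, 'r) mwgraph) a x y) +
      bracket d (mark_vertex (reweight (edge_graph a v A B i j :: ('v, 'l, 'r) mwgraph) a x\<^sub>m 0) a)"
    unfolding universal_weights_def by blast
  then show ?thesis
    unfolding bracket_cong_edges[OF E] bracket_edge_graph[OF \<open>a \<noteq> v\<close>]
      bracket_edge_graph_marked[OF \<open>a \<noteq> v\<close>] .
qed

theorem corollary7:
  fixes A B d :: "'r::comm_ring_1"
    and F :: "('v::infinite, 'l::infinite, 'r) mwgraph"
    and a v10 v01 :: 'v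
    and \<alpha>_a \<beta>_a \<alpha>_am :: 'r
  assumes "is_mwgraph F"
    and "a \<in> verts F"
    and "\<not> looped F a"
    and "a \<notin> marked F"
    and "standard_weights A B F a"
    and "universal_weights A B d F a \<alpha>_a \<beta>_a \<alpha>_am"
    and "v10 \<notin> verts F"
    and "v01 \<notin> verts F"
  shows "(2 - d - d\<^sup>2) * \<alpha>_a =
           - (d + 1) * bracket d (delete_vertex F a) +
           bracket d (replace_vertex F a v10 1 0) + bracket d (replace_vertex F a v01 0 1) \<and>
         (2 - d - d\<^sup>2) * \<beta>_a =
           bracket d (delete_vertex F a) +
           bracket d (replace_vertex F a v10 1 0) - (d + 1) * bracket d (replace_vertex F a v01 0 1) \<and>
         (2 - d - d\<^sup>2) * \<alpha>_am =
           bracket d (delete_vertex F a) -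
           (d + 1) * bracket d (replace_vertex F a v10 1 0) + bracket d (replace_vertex F a v01 0 1)"
  \<comment> \<open>Each universal weight has coefficient \<open>d\<close> in exactly one of the
    three equations and 1 in the other two. Adding these two to \<open>-(d + 1)\<close> times the
    first cancels the other weights, as \<open>-(d + 1) + 1 + d = 0\<close>, and leaves the
    coefficient \<open>2 - d * (d + 1)\<close>.\<close>
  unfolding universal_weights_delete_vertex[OF assms(1-6)]
    universal_weights_replace_vertex[OF assms(1-7)]
    universal_weights_replace_vertex[OF assms(1-6,8)]
  by (simp add: algebra_simps power2_eq_square)

end
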